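(* Consider $\min_{\mathbf{x}\in\mathbb{R}^n}\max_{\mathbf{y}\in\mathbb{R}^m}F(\mathbf{x})+H(\mathbf{x},\mathbf{y})-G(\mathbf{y})$ with $H(\mathbf{x},\mathbf{y})=\mathbf{x}^\top\mathbf{B}\mathbf{y}-\mathbf{x}^\top\mathbf{u}_{\mathbf{x}}+\mathbf{u}_{\mathbf{y}}^\top\mathbf{y}$, where $F$ is $L_F$-smooth and $\mu_F$-strongly convex, $G$ is $L_G$-smooth and $\mu_G$-strongly convex ($\mu_F,\mu_G>0$), with unique saddle point $(\boldsymbol{\omega}_{\mathbf{x}}^\star,\boldsymbol{\omega}_{\mathbf{y}}^\star)$. Set $$L_{\mathrm{Str}}=L_F\vee\left(\tfrac{\mu_F}{\mu_G}L_G\right)-\mu_F,\quad L_{\mathrm{Bil}}=\sqrt{\lambda_{\max}(\mathbf{B}^\top\mathbf{B})\cdot\tfrac{\mu_F}{\mu_G}+\mu_F^2},\quad \mu_\star=\mu_F,\quad \mathcal{R}=\tfrac{\mu_G}{\mu_F}.$$ Choose $\alpha_t\equiv\bar\alpha=\dfrac{1}{1+\sqrt{1+\frac{L_{\mathrm{Str}}}{\mu_\star}+\frac{L_{\mathrm{Bil}}^2}{\mu_\star^2}}}$ and $\eta_t\equiv\frac{\bar\alpha}{\mu_\star}$. Then for every $\mathscr{T}\ge1$ the output of the direct deterministic AG-EG algorithm (see context) satisfies $$\|\mathbf{x}_{\mathscr{T}}-\boldsymbol{\omega}_{\mathbf{x}}^\star\|^2+\mathcal{R}\|\mathbf{y}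_{\mathscr{T}}-\boldsymbol{\omega}_{\mathbf{y}}^\star\|^2\le\left[\|\mathbf{x}_0-\boldsymbol{\omega}_{\mathbf{x}}^\star\|^2+\mathcal{R}\|\mathbf{y}_0-\boldsymbol{\omega}_{\mathbf{y}}^\star\|^2\right]\left(\tfrac{L_{\mathrm{Str}}}{\mu_\star}+1\right)\exp\left(-\frac{\mathscr{T}}{1+\sqrt{1+\frac{L_{\mathrm{Str}}}{\mu_\star}+\frac{L_{\mathrm{Bil}}^2}{\mu_\star^2}}}\right).$$
   Context: Norms are Euclidean; $a\vee b=\max(a,b)$; $\lambda_{\max}$ is the largest eigenvalue; $\mathbf{B}\in\mathbb{R}^{n\times m}$ with $n\ge m$ (without loss of generality). "$L$-smooth and $\mu$-strongly convex" means $\frac{\mu}{2}\|\mathbf{x}-\mathbf{x}'\|^2\le F(\mathbf{x})-F(\mathbf{x}')-\nabla F(\mathbf{x}')^\top(\mathbf{x}-\mathbf{x}')\le\frac{L}{2}\|\mathbf{x}-\mathbf{x}'\|^2$ for all $\mathbf{x},\mathbf{x}'$. A saddle point satisfies $\mathscr{F}(\boldsymbol{\omega}_{\mathbf{x}}^\star,\mathbf{y})\le\mathscr{F}(\boldsymbol{\omega}_{\mathbf{x}}^\star,\boldsymbol{\omega}_{\mathbf{y}}^\star)\le\mathscr{F}(\mathbf{x},\boldsymbol{\omega}_{\mathbf{y}}^\star)$ for all $\mathbf{x},\mathbf{y}$, where $\mathscr{F}=F+H-G$. Direct deterministic AG-EG algorithm: from $[\mathbf{x}_0;\mathbf{y}_0]$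 set $\mathbf{x}^{\mathrm{ag}}_{-1/2}=\mathbf{x}^{\mathrm{md}}_0=\mathbf{x}_0$, $\mathbf{y}^{\mathrm{ag}}_{-1/2}=\mathbf{y}^{\mathrm{md}}_0=\mathbf{y}_0$. For $t=1,\dots,\mathscr{T}$ set $\mathbf{x}_{t-\frac12}=\mathbf{x}_{t-1}-\eta_t(\nabla F(\mathbf{x}^{\mathrm{md}}_{t-1})+\nabla_{\mathbf{x}}H(\mathbf{x}_{t-1},\mathbf{y}_{t-1})-\mu_F(\mathbf{x}^{\mathrm{md}}_{t-1}-\mathbf{x}_{t-1}))$, $\mathbf{y}_{t-\frac12}=\mathbf{y}_{t-1}-\frac{\eta_t}{\mathcal{R}}(-\nabla_{\mathbf{y}}H(\mathbf{x}_{t-1},\mathbf{y}_{t-1})+\nabla G(\mathbf{y}^{\mathrm{md}}_{t-1})-\mu_G(\mathbf{y}^{\mathrm{md}}_{t-1}-\mathbf{y}_{t-1}))$, $\mathbf{x}^{\mathrm{ag}}_{t-\frac12}=(1-\alpha_t)\mathbf{x}^{\mathrm{ag}}_{t-\frac32}+\alpha_t\mathbf{x}_{t-\frac12}$, $\ \mathbf{y}^{\mathrm{ag}}_{t-\frac12}=(1-\alpha_t)\mathbf{y}^{\mathrm{ag}}_{t-\frac32}+\alpha_t\mathbf{y}_{t-\frac12}$, $\mathbf{x}_t=\mathbf{x}_{t-1}-\eta_t(\nabla F(\mathbf{x}^{\mathrm{md}}_{t-1})+\nabla_{\mathbf{x}}H(\mathbf{x}_{t-\frac12},\mathbf{y}_{t-\frac12})-\mu_F(\mathbf{x}^{\mathrm{md}}_{t-1}-\mathbf{x}_{t-\frac12}))$,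 $\mathbf{y}_t=\mathbf{y}_{t-1}-\frac{\eta_t}{\mathcal{R}}(-\nabla_{\mathbf{y}}H(\mathbf{x}_{t-\frac12},\mathbf{y}_{t-\frac12})+\nabla G(\mathbf{y}^{\mathrm{md}}_{t-1})-\mu_G(\mathbf{y}^{\mathrm{md}}_{t-1}-\mathbf{y}_{t-\frac12}))$, $\mathbf{x}^{\mathrm{md}}_t=(1-\alpha_{t+1})\mathbf{x}^{\mathrm{ag}}_{t-\frac12}+\alpha_{t+1}\mathbf{x}_t$, $\ \mathbf{y}^{\mathrm{md}}_t=(1-\alpha_{t+1})\mathbf{y}^{\mathrm{ag}}_{t-\frac12}+\alpha_{t+1}\mathbf{y}_t$. The output is $[\mathbf{x}_{\mathscr{T}};\mathbf{y}_{\mathscr{T}}]$. *)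

theory Defs
  imports "HOL-Analysis.Analysis"
begin

definition gradient :: "('a::real_inner \<Rightarrow> real) \<Rightarrow> 'a \<Rightarrow> 'a"
  where "gradient f x = (THE g. GDERIV f x :> g)"

definition smooth_strongly_convex :: "real \<Rightarrow> real \<Rightarrow> ('a::euclidean_space \<Rightarrow> real) \<Rightarrow> bool"
  where "smooth_strongly_convex L \<mu> f \<longleftrightarrow>
    (\<forall>x. f differentiable (at x)) \<and>
    (\<forall>x x'. \<mu> / 2 * (norm (x - x'))\<^sup>2 \<le> f x - f x' - gradient f x' \<bullet> (x - x') \<and>
            f x - f x' - gradient f x' \<bullet> (x - x') \<le> L / 2 * (norm (x - x'))\<^sup>2)"

definition saddle_point :: "('a \<Rightarrow> 'b \<Rightarrow> real) \<Rightarrow> 'a \<Rightarrow> 'b \<Rightarrow> bool"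
  where "saddle_point \<Phi> wx wy \<longleftrightarrow> (\<forall>x y. \<Phi> wx y \<le> \<Phi> wx wy \<and> \<Phi> wx wy \<le> \<Phi> x wy)"

definition eigenvalue :: "real^'k^'k \<Rightarrow> real \<Rightarrow> bool"
  where "eigenvalue A c \<longleftrightarrow> (\<exists>v. v \<noteq> 0 \<and> A *v v = c *\<^sub>R v)"

text \<open>Only real eigenvalues are considered, so this is meant for symmetric matrices,
  where all eigenvalues are real and a largest one exists.\<close>

definition lambda_max :: "real^'k^'k \<Rightarrow> real"
  where "lambda_max A = (GREATEST c. eigenvalue A c)"

definition coupling ::
    "real^'m^'n \<Rightarrow> real^'n \<Rightarrow> real^'m \<Rightarrow> real^'n \<Rightarrow> real^'m \<Rightarrow> real"
  where "coupling B ux uy x y = x \<bullet> (B *v y) - x \<bullet> ux + uy \<bullet> y"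

text \<open>The state after step \<open>t\<close> collects \<open>x\<^sub>t\<close>, \<open>y\<^sub>t\<close>, the averaged points with the half-integer
  index \<open>t - 1/2\<close>, and the extrapolated points with index \<open>t\<close>. The half-step iterates are
  local to a step.\<close>

record ('a, 'b) ag_eg_state =
  x_it :: 'a
  y_it :: 'b
  x_ag :: 'a
  y_ag :: 'b
  x_md :: 'a
  y_md :: 'b

definition ag_eg_step ::
    "('a::real_inner \<Rightarrow> real) \<Rightarrow> ('b::real_inner \<Rightarrow> real) \<Rightarrow> ('a \<Rightarrow> 'b \<Rightarrow> real) \<Rightarrow> real \<Rightarrow> real \<Rightarrow>
     real \<Rightarrow> (nat \<Rightarrow> real) \<Rightarrow> (nat \<Rightarrow> real) \<Rightarrow> nat \<Rightarrow> ('a, 'b) ag_eg_state \<Rightarrow> ('a, 'b) ag_eg_state"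
  where "ag_eg_step F G H \<mu>F \<mu>G R \<alpha> \<eta> t s =
    (let x = x_it s; y = y_it s; xmd = x_md s; ymd = y_md s;
         xh = x - \<eta> t *\<^sub>R (gradient F xmd + gradient (\<lambda>u. H u y) x - \<mu>F *\<^sub>R (xmd - x));
         yh = y - (\<eta> t / R) *\<^sub>R (- gradient (\<lambda>v. H x v) y + gradient G ymd - \<mu>G *\<^sub>R (ymd - y));
         xag = (1 - \<alpha> t) *\<^sub>R x_ag s + \<alpha> t *\<^sub>R xh;
         yag = (1 - \<alpha> t) *\<^sub>R y_ag s + \<alpha> t *\<^sub>R yh;
         x' = x - \<eta> t *\<^sub>R (gradient F xmd + gradient (\<lambda>u. H u yh) xh - \<mu>F *\<^sub>R (xmd - xh));
         y' = y - (\<eta> t / R) *\<^sub>R (- gradient (\<lambda>v. H xh v) yh + gradient G ymd - \<mu>G *\<^sub>R (ymd - yh))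
     in \<lparr> x_it = x', y_it = y', x_ag = xag, y_ag = yag,
          x_md = (1 - \<alpha> (t + 1)) *\<^sub>R xag + \<alpha> (t + 1) *\<^sub>R x',
          y_md = (1 - \<alpha> (t + 1)) *\<^sub>R yag + \<alpha> (t + 1) *\<^sub>R y' \<rparr>)"

primrec ag_eg ::
    "('a::real_inner \<Rightarrow> real) \<Rightarrow> ('b::real_inner \<Rightarrow> real) \<Rightarrow> ('a \<Rightarrow> 'b \<Rightarrow> real) \<Rightarrow> real \<Rightarrow> real \<Rightarrow>
     real \<Rightarrow> (nat \<Rightarrow> real) \<Rightarrow> (nat \<Rightarrow> real) \<Rightarrow> 'a \<Rightarrow> 'b \<Rightarrow> nat \<Rightarrow> ('a, 'b) ag_eg_state"
  where
    "ag_eg F G H \<mu>F \<mu>G R \<alpha> \<eta> x0 y0 0 =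
      \<lparr> x_it = x0, y_it = y0, x_ag = x0, y_ag = y0, x_md = x0, y_md = y0 \<rparr>"
  | "ag_eg F G H \<mu>F \<mu>G R \<alpha> \<eta> x0 y0 (Suc t) =
      ag_eg_step F G H \<mu>F \<mu>G R \<alpha> \<eta> (Suc t) (ag_eg F G H \<mu>F \<mu>G R \<alpha> \<eta> x0 y0 t)"

end

theory Submission
  imports Defs
begin

text \<open>
  Rescaling \<open>y\<close> by \<open>sqrt R\<close> and moving the quadratic part of \<open>F\<close> and \<open>G\<close> into the bilinear
  part turns the algorithm into an extragradient method with operator \<open>\<nabla>\<phi> + W\<close>, where
  \<open>\<phi>\<close> is convex and \<open>L_Str\<close>-smooth and \<open>W\<close> is \<open>\<mu>\<close>-strongly monotone and
  \<open>L_Bil\<close>-Lipschitz (the two summands of \<open>L_Bil\<^sup>2\<close> come from the orthogonality of the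
  skew part and the identity part of \<open>W\<close>). The Lyapunov function is the Bregman divergence of
  \<open>\<phi>\<close> between the averaged point and the solution plus \<open>\<mu>/2\<close> times the squared distance of
  the iterate to the solution. It contracts by \<open>1 - \<alpha>\<close> in each step; the remaining multiple of
  the squared half-step length vanishes since \<open>\<alpha>\<close> solves
  \<open>\<alpha>\<^sup>2 (L_Str/\<mu> + L_Bil\<^sup>2/\<mu>\<^sup>2) + 2 \<alpha> = 1\<close>.
\<close>

text \<open>Along \<open>d = e *\<^sub>R c\<close> the left side is of order \<open>e\<close> and
  the right side of order \<open>e\<^sup>2\<close>, so a small \<open>e\<close> with
  \<open>K * e < 1\<close> rules out \<open>c \<noteq> 0\<close>. This extracts first-order
  conditions from extremality.\<close>

lemma linear_le_quadratic_imp_zero: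
  fixes c :: "'a::real_inner" and K :: real
  assumes "\<And>d. c \<bullet> d \<le> K * (norm d)\<^sup>2"
  shows "c = 0"
proof (rule ccontr)
  assume "c \<noteq> 0"
  define e where "e = 1 / (\<bar>K\<bar> + 1)"
  have e: "e > 0" "K * e < 1"
    by (auto simp: e_def divide_simps)
  have "e * (norm c)\<^sup>2 \<le> K * e\<^sup>2 * (norm c)\<^sup>2"
    using assms[of "e *\<^sub>R c"] by (simp add: power_mult_distrib power2_norm_eq_inner)
  hence "e \<le> K * e\<^sup>2"
    using \<open>c \<noteq> 0\<close> by simp
  hence "e * 1 \<le> e * (K * e)"
    by (simp add: power2_eq_square algebra_simps)
  thus False
    using e by (simp only: mult_le_cancel_left_pos)
qed

section \<open>The largest eigenvalue of a Gram matrix\<close>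

text \<open>The Rayleigh quotient attains its maximum \<open>M\<close> on the unit sphere by
  compactness. The first variation makes the maximizer an eigenvector for \<open>M\<close>, and
  every eigenvalue is itself a value of the quotient, hence at most \<open>M\<close>.\<close>

lemma lambda_max_gram:
  fixes B :: "real^'m^'n"
  shows "(norm (B *v u))\<^sup>2 \<le> lambda_max (transpose B ** B) * (norm u)\<^sup>2"
    and "0 \<le> lambda_max (transpose B ** B)"
proof -
  have "compact (sphere (0::real^'m) 1)" "sphere (0::real^'m) 1 \<noteq> {}"
    by auto
  moreover have "continuous_on (sphere 0 1) (\<lambda>v. (norm (B *v v))\<^sup>2)"
    by (intro continuous_intros)
  ultimately obtain v where v: "norm v = 1"
    and max: "\<And>u. norm u = 1 \<Longrightarrow> (norm (B *v u))\<^sup>2 \<le> (norm (B *v v))\<^sup>2"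
    using continuous_attains_sup[of "sphere (0::real^'m) 1" "\<lambda>v. (norm (B *v v))\<^sup>2"] by auto
  define M where "M = (norm (B *v v))\<^sup>2"
  have bound: "(norm (B *v u))\<^sup>2 \<le> M * (norm u)\<^sup>2" for u
  proof (cases "u = 0")
    case False
    with max[of "(1 / norm u) *\<^sub>R u"] show ?thesis
      by (simp add: M_def matrix_vector_mult_scaleR power_divide divide_simps)
  qed simp
  have inner_gram: "((transpose B ** B) *v a) \<bullet> b = (B *v a) \<bullet> (B *v b)" for a b
    by (simp add: matrix_vector_mul_assoc[symmetric] dot_lmul_matrix[symmetric]
        transpose_matrix_vector)
  have "(transpose B ** B) *v v - M *\<^sub>R v = 0"
  proof (rule linear_le_quadratic_imp_zero[where K = "M / 2"])
    fix d
    \<comment> \<open>The constant terms on both sides equal \<open>M\<close>. Dropping the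
      nonnegative \<open>(norm (B *v d))\<^sup>2\<close> leaves twice the linear term below
      \<open>M * (norm d)\<^sup>2\<close>, hence \<open>K = M / 2\<close>.\<close>
    have "(norm (B *v (v + d)))\<^sup>2 \<le> M * (norm (v + d))\<^sup>2"
      by (rule bound)
    moreover have "(norm (B *v (v + d)))\<^sup>2 = M + 2 * ((B *v v) \<bullet> (B *v d)) + (norm (B *v d))\<^sup>2"
      by (simp add: M_def matrix_vector_right_distrib power2_norm_eq_inner algebra_simps inner_commute)
    moreover have "M * (norm (v + d))\<^sup>2 = M + 2 * (M * (v \<bullet> d)) + M * (norm d)\<^sup>2"
      using v by (simp add: power2_norm_eq_inner algebra_simps inner_commute norm_eq_1)
    moreover have "(norm (B *v d))\<^sup>2 \<ge> 0"
      by simp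
    ultimately have "(B *v v) \<bullet> (B *v d) - M * (v \<bullet> d) \<le> M / 2 * (norm d)\<^sup>2"
      by linarith
    thus "((transpose B ** B) *v v - M *\<^sub>R v) \<bullet> d \<le> M / 2 * (norm d)\<^sup>2"
      by (simp add: inner_diff_left inner_gram)
  qed
  hence "eigenvalue (transpose B ** B) M"
    using v unfolding eigenvalue_def by (intro exI[of _ v]) auto
  moreover have "c \<le> M" if "eigenvalue (transpose B ** B) c" for c
  proof -
    obtain u where u: "u \<noteq> 0" "(transpose B ** B) *v u = c *\<^sub>R u"
      using \<open>eigenvalue _ c\<close> unfolding eigenvalue_def by blast
    have "c * (norm u)\<^sup>2 = (norm (B *v u))\<^sup>2"
      using inner_gram[of u u] u by (simp add: power2_norm_eq_inner)
    with bound[of u] have "c * (norm u)\<^sup>2 \<le> M * (norm u)\<^sup>2"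
      by simp
    with u(1) show ?thesis
      by (simp add: mult_le_cancel_right)
  qed
  ultimately have "lambda_max (transpose B ** B) = M"
    unfolding lambda_max_def by (intro Greatest_equality) auto
  thus "(norm (B *v u))\<^sup>2 \<le> lambda_max (transpose B ** B) * (norm u)\<^sup>2"
    "0 \<le> lambda_max (transpose B ** B)"
    using bound by (auto simp: M_def)
qed

text \<open>A matrix and its transpose have the same operator norm: apply Cauchy-Schwarz to
  \<open>(norm b)\<^sup>2 = (B *v b) \<bullet> x\<close>, square, use the Gram bound, and cancel one
  factor \<open>(norm b)\<^sup>2\<close>.\<close>

lemma lambda_max_gram_transpose:
  fixes B :: "real^'m^'n"
  shows "(norm (transpose B *v x))\<^sup>2 \<le> lambda_max (transpose B ** B) * (norm x)\<^sup>2"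
proof (cases "transpose B *v x = 0")
  case True
  thus ?thesis by (simp add: lambda_max_gram)
next
  case False
  define b where "b = transpose B *v x"
  have "(norm b)\<^sup>2 = (B *v b) \<bullet> x"
    by (simp add: b_def power2_norm_eq_inner dot_lmul_matrix transpose_matrix_vector inner_commute)
  also have "\<dots> \<le> norm (B *v b) * norm x"
    by (rule norm_cauchy_schwarz)
  finally have "((norm b)\<^sup>2)\<^sup>2 \<le> (norm (B *v b))\<^sup>2 * (norm x)\<^sup>2"
    by (metis power_mono power_mult_distrib zero_le_power2)
  also have "\<dots> \<le> lambda_max (transpose B ** B) * (norm b)\<^sup>2 * (norm x)\<^sup>2"
    by (intro mult_right_mono lambda_max_gram) auto
  finally have "(norm b)\<^sup>2 * (norm b)\<^sup>2 \<le> (norm b)\<^sup>2 * (lambda_max (transpose B ** B) * (norm x)\<^sup>2)"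
    by (simp add: power2_eq_square algebra_simps)
  moreover have "(norm b)\<^sup>2 > 0"
    using False by (simp add: b_def)
  ultimately show ?thesis
    by (simp only: mult_le_cancel_left_pos b_def)
qed

section \<open>Gradients and optimality\<close>

lemma gradient_eqI:
  assumes "GDERIV f x :> g"
  shows "gradient f x = g"
proof -
  have "h = g" if "GDERIV f x :> h" for h
  proof -
    have "(\<lambda>d. h \<bullet> d) = (\<lambda>d. g \<bullet> d)"
      using that assms unfolding gderiv_def
      by (auto intro: has_derivative_unique simp: inner_commute)
    thus ?thesis
      by (metis inner_commute vector_eq_rdot)
  qed
  with assms show ?thesis
    unfolding gradient_def by blast
qed

lemma gradient_affine:
  fixes f :: "'a::real_inner \<Rightarrow> real"
  assumes "\<And>u. f u = c \<bullet> u + k"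
  shows "gradient f x = c"
proof (rule gradient_eqI)
  have "f = (\<lambda>u. c \<bullet> u + k)"
    using assms by auto
  thus "GDERIV f x :> c"
    unfolding gderiv_def by (auto intro!: derivative_eq_intros simp: inner_commute)
qed

lemma gradient_coupling:
  shows "gradient (\<lambda>u. coupling B ux uy u y) x = B *v y - ux"
    and "gradient (\<lambda>v. coupling B ux uy x v) y = transpose B *v x + uy"
proof -
  show "gradient (\<lambda>u. coupling B ux uy u y) x = B *v y - ux"
    by (rule gradient_affine[where k = "uy \<bullet> y"])
      (simp add: coupling_def algebra_simps inner_commute)
  have "x \<bullet> (B *v v) = (transpose B *v x) \<bullet> v" for v
    by (simp add: dot_lmul_matrix transpose_matrix_vector)
  thus "gradient (\<lambda>v. coupling B ux uy x v) y = transpose B *v x + uy"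
    by (intro gradient_affine[where k = "- (x \<bullet> ux)"]) (simp add: coupling_def algebra_simps)
qed

text \<open>Minimality bounds \<open>- (gradient f w + c) \<bullet> d\<close> by the first-order
  remainder of \<open>f\<close> at \<open>w\<close>, which smoothness makes at most quadratic in
  \<open>d\<close>.\<close>

lemma smooth_minimizer_stationary:
  fixes f :: "'a::euclidean_space \<Rightarrow> real"
  assumes "smooth_strongly_convex L \<mu> f"
    and "\<And>x. f w + c \<bullet> w \<le> f x + c \<bullet> x"
  shows "gradient f w + c = 0"
proof -
  have "- (gradient f w + c) = 0"
  proof (rule linear_le_quadratic_imp_zero[where K = "L / 2"])
    fix d
    have "f (w + d) - f w - gradient f w \<bullet> d \<le> L / 2 * (norm d)\<^sup>2"
      using assms(1)[unfolded smooth_strongly_convex_def, THEN conjunct2, rule_format, of "w + d" w]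
      by simp
    with assms(2)[of "w + d"] show "- (gradient f w + c) \<bullet> d \<le> L / 2 * (norm d)\<^sup>2"
      by (simp add: algebra_simps)
  qed
  thus ?thesis by (simp only: neg_equal_0_iff_equal)
qed

text \<open>Compare the two quadratic bounds at a unit vector. This yields
  \<open>0 \<le> L_Str\<close> later.\<close>

lemma smooth_strongly_convex_le:
  assumes "smooth_strongly_convex L \<mu> (f :: 'a::euclidean_space \<Rightarrow> real)"
  shows "\<mu> \<le> L"
proof -
  obtain b :: 'a where "norm b = 1"
    using vector_choose_size zero_le_one by blast
  moreover have "\<mu> / 2 * (norm (b - 0))\<^sup>2 \<le> L / 2 * (norm (b - 0))\<^sup>2"
    using assms unfolding smooth_strongly_convex_def by (blast intro: order_trans)
  ultimately show ?thesis by simp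
qed

text \<open>\<open>D\<close> is the Bregman divergence of \<open>f\<close> minus its quadratic part.
  The quadratic has divergence \<open>\<mu> / 2 * (norm (a - b))\<^sup>2\<close>, so both bounds
  drop by exactly that amount.\<close>

lemma smooth_strongly_convex_shift:
  assumes "smooth_strongly_convex L \<mu> f"
  defines "D \<equiv> \<lambda>a b. (f a - \<mu> / 2 * (norm a)\<^sup>2) - (f b - \<mu> / 2 * (norm b)\<^sup>2)
      - (gradient f b - \<mu> *\<^sub>R b) \<bullet> (a - b)"
  shows "0 \<le> D a b" and "D a b \<le> (L - \<mu>) / 2 * (norm (a - b))\<^sup>2"
proof -
  have eq: "D a b = f a - f b - gradient f b \<bullet> (a - b) - \<mu> / 2 * (norm (a - b))\<^sup>2"
    unfolding D_def by (simp add: power2_norm_eq_inner algebra_simps inner_commute)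
  have "\<mu> / 2 * (norm (a - b))\<^sup>2 \<le> f a - f b - gradient f b \<bullet> (a - b)"
    "f a - f b - gradient f b \<bullet> (a - b) \<le> L / 2 * (norm (a - b))\<^sup>2"
    using assms(1) unfolding smooth_strongly_convex_def by blast+
  thus "0 \<le> D a b" "D a b \<le> (L - \<mu>) / 2 * (norm (a - b))\<^sup>2"
    unfolding eq by (auto simp: algebra_simps diff_divide_distrib)
qed

section \<open>Accelerated extragradient for a smooth plus a monotone operator\<close>

text \<open>Half-integer indices are shifted: \<open>ag t\<close> stands for time
  \<open>t - 1/2\<close> and \<open>zh t\<close> for time \<open>t + 1/2\<close>. Both updates start
  at \<open>z t\<close> and share \<open>g (md t)\<close>; only the argument of \<open>W\<close>
  changes.\<close>

locale accelerated_extragradient =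
  fixes \<phi> :: "'a::real_inner \<Rightarrow> real" and g W :: "'a \<Rightarrow> 'a" and w :: 'a
    and L K \<mu> \<alpha> :: real
    and z zh ag md :: "nat \<Rightarrow> 'a"
  assumes mu_pos: "0 < \<mu>" and L_nonneg: "0 \<le> L"
    and alpha: "\<alpha> = 1 / (1 + sqrt (1 + L / \<mu> + K\<^sup>2 / \<mu>\<^sup>2))"
    and convex: "\<And>a b. 0 \<le> \<phi> a - \<phi> b - g b \<bullet> (a - b)"
    and smooth: "\<And>a b. \<phi> a - \<phi> b - g b \<bullet> (a - b) \<le> L / 2 * (norm (a - b))\<^sup>2"
    and monotone: "\<And>a b. \<mu> * (norm (a - b))\<^sup>2 \<le> (W a - W b) \<bullet> (a - b)"
    and lipschitz: "\<And>a b. (norm (W a - W b))\<^sup>2 \<le> K\<^sup>2 * (norm (a - b))\<^sup>2"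
    and solution: "g w + W w = 0"
    and ag_0: "ag 0 = z 0"
    and md: "\<And>t. md t = (1 - \<alpha>) *\<^sub>R ag t + \<alpha> *\<^sub>R z t"
    and zh: "\<And>t. zh t = z t - (\<alpha> / \<mu>) *\<^sub>R (g (md t) + W (z t))"
    and ag_Suc: "\<And>t. ag (Suc t) = (1 - \<alpha>) *\<^sub>R ag t + \<alpha> *\<^sub>R zh t"
    and z_Suc: "\<And>t. z (Suc t) = z t - (\<alpha> / \<mu>) *\<^sub>R (g (md t) + W (zh t))"
begin

definition D :: "'a \<Rightarrow> real"
  where "D a = \<phi> a - \<phi> w - g w \<bullet> (a - w)"

definition lyapunov :: "nat \<Rightarrow> real"
  where "lyapunov t = D (ag t) + \<mu> / 2 * (norm (z t - w))\<^sup>2"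

text \<open>With \<open>s\<close> the square root, the bracket is \<open>s\<^sup>2 - 1\<close>, and
  adding \<open>2 * (1 + s)\<close> completes the square that cancels the denominator of
  \<open>\<alpha>\<^sup>2\<close>.\<close>

lemma alpha_props: "0 < \<alpha>" "\<alpha> \<le> 1" "\<alpha>\<^sup>2 * (L / \<mu> + K\<^sup>2 / \<mu>\<^sup>2) + 2 * \<alpha> = 1"
proof -
  define s where "s = sqrt (1 + L / \<mu> + K\<^sup>2 / \<mu>\<^sup>2)"
  have nonneg: "0 \<le> 1 + L / \<mu> + K\<^sup>2 / \<mu>\<^sup>2"
    using mu_pos L_nonneg by (intro add_nonneg_nonneg) auto
  hence s: "s \<ge> 0" "L / \<mu> + K\<^sup>2 / \<mu>\<^sup>2 = s\<^sup>2 - 1"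
    by (simp_all add: s_def)
  have a: "\<alpha> = 1 / (1 + s)"
    by (simp add: alpha s_def)
  show "0 < \<alpha>" "\<alpha> \<le> 1"
    using s by (auto simp: a)
  have "\<alpha>\<^sup>2 * (s\<^sup>2 - 1) + 2 * \<alpha> = ((s\<^sup>2 - 1) + 2 * (1 + s)) / (1 + s)\<^sup>2"
    using s(1) by (simp add: a power2_eq_square divide_simps)
  also have "(s\<^sup>2 - 1) + 2 * (1 + s) = (1 + s)\<^sup>2"
    by (simp add: power2_eq_square algebra_simps)
  finally show "\<alpha>\<^sup>2 * (L / \<mu> + K\<^sup>2 / \<mu>\<^sup>2) + 2 * \<alpha> = 1"
    using s by simp
qed

text \<open>Add smoothness from \<open>md t\<close> to the new average and convexity from
  \<open>md t\<close> to \<open>ag t\<close> and to \<open>w\<close>, with weights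
  \<open>1 - \<alpha>\<close> and \<open>\<alpha>\<close>. The values at \<open>md t\<close> cancel;
  since \<open>md t\<close> and \<open>ag (Suc t)\<close> share the part \<open>ag t\<close>, the
  smoothness error carries \<open>\<alpha>\<^sup>2\<close>.\<close>

lemma D_ag_Suc:
  "D (ag (Suc t)) \<le> (1 - \<alpha>) * D (ag t) + \<alpha> * ((g (md t) - g w) \<bullet> (zh t - w))
     + L * \<alpha>\<^sup>2 / 2 * (norm (zh t - z t))\<^sup>2"
proof -
  have diff: "ag (Suc t) - md t = \<alpha> *\<^sub>R (zh t - z t)"
    by (simp add: ag_Suc md algebra_simps)
  have "\<phi> (ag (Suc t)) - \<phi> (md t) - g (md t) \<bullet> (ag (Suc t) - md t)
      \<le> L * \<alpha>\<^sup>2 / 2 * (norm (zh t - z t))\<^sup>2"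
    using smooth[of "ag (Suc t)" "md t"] by (simp add: diff power_mult_distrib)
  moreover have "(1 - \<alpha>) * (\<phi> (ag t) - \<phi> (md t) - g (md t) \<bullet> (ag t - md t)) \<ge> 0"
    using alpha_props convex by (intro mult_nonneg_nonneg) auto
  moreover have "\<alpha> * (\<phi> w - \<phi> (md t) - g (md t) \<bullet> (w - md t)) \<ge> 0"
    using alpha_props convex by (intro mult_nonneg_nonneg) auto
  moreover have "c \<bullet> ag (Suc t) = (1 - \<alpha>) * (c \<bullet> ag t) + \<alpha> * (c \<bullet> zh t)" for c
    by (simp add: ag_Suc inner_add_right)
  note this[of "g (md t)"] this[of "g w"]
  ultimately show ?thesis
    by (simp add: D_def inner_diff_left inner_diff_right algebra_simps)
qed

text \<open>The equation for \<open>w\<close> turns the gap into the full update direction minus a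
  \<open>W\<close>-difference, which strong monotonicity bounds below. The direction term is a
  difference of squared distances plus an extragradient error.\<close>

lemma extragradient_step:
  "\<alpha> * ((g (md t) - g w) \<bullet> (zh t - w))
     \<le> \<mu> / 2 * ((norm (z t - w))\<^sup>2 - (norm (z (Suc t) - w))\<^sup>2
          - (1 - \<alpha>\<^sup>2 * K\<^sup>2 / \<mu>\<^sup>2) * (norm (zh t - z t))\<^sup>2)
       - \<alpha> * \<mu> * (norm (zh t - w))\<^sup>2"
proof -
  have "g w = - W w"
    using solution by (simp add: add_eq_0_iff2)
  hence "\<alpha> * ((g (md t) - g w) \<bullet> (zh t - w))
      = \<alpha> * ((g (md t) + W (zh t)) \<bullet> (zh t - w)) - \<alpha> * ((W (zh t) - W w) \<bullet> (zh t - w))"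
    by (simp add: algebra_simps)
  also have "\<dots> \<le> \<alpha> * ((g (md t) + W (zh t)) \<bullet> (zh t - w)) - \<alpha> * (\<mu> * (norm (zh t - w))\<^sup>2)"
    using alpha_props monotone by (intro diff_left_mono mult_left_mono) auto
  finally have *: "\<alpha> * ((g (md t) - g w) \<bullet> (zh t - w))
      \<le> \<alpha> * ((g (md t) + W (zh t)) \<bullet> (zh t - w)) - \<alpha> * \<mu> * (norm (zh t - w))\<^sup>2"
    by (simp add: mult.assoc)
  have "\<alpha> *\<^sub>R (g (md t) + W (zh t)) = \<mu> *\<^sub>R (z t - z (Suc t))"
    using mu_pos by (simp add: z_Suc)
  hence "\<alpha> * ((g (md t) + W (zh t)) \<bullet> (zh t - w)) = \<mu> * ((z t - z (Suc t)) \<bullet> (zh t - w))"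
    by (metis inner_scaleR_left)
  \<comment> \<open>Four-point identity for squared Euclidean distances.\<close>
  also have "(z t - z (Suc t)) \<bullet> (zh t - w) = 1 / 2 * ((norm (z t - w))\<^sup>2 - (norm (z (Suc t) - w))\<^sup>2
      + (norm (zh t - z (Suc t)))\<^sup>2 - (norm (zh t - z t))\<^sup>2)"
    by (simp add: power2_norm_eq_inner algebra_simps inner_commute)
  finally have eq: "\<alpha> * ((g (md t) + W (zh t)) \<bullet> (zh t - w)) = \<mu> / 2 *
      ((norm (z t - w))\<^sup>2 - (norm (z (Suc t) - w))\<^sup>2
      + (norm (zh t - z (Suc t)))\<^sup>2 - (norm (zh t - z t))\<^sup>2)"
    by simp
  \<comment> \<open>The shared gradient at \<open>md t\<close> cancels, so the error is controlled
    by the Lipschitz bound on \<open>W\<close> alone.\<close>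
  have "zh t - z (Suc t) = (\<alpha> / \<mu>) *\<^sub>R (W (zh t) - W (z t))"
    unfolding zh z_Suc by (simp add: algebra_simps)
  hence "(norm (zh t - z (Suc t)))\<^sup>2 = (\<alpha> / \<mu>)\<^sup>2 * (norm (W (zh t) - W (z t)))\<^sup>2"
    by (simp add: power_mult_distrib power_divide)
  also have "\<dots> \<le> (\<alpha> / \<mu>)\<^sup>2 * (K\<^sup>2 * (norm (zh t - z t))\<^sup>2)"
    by (intro mult_left_mono lipschitz) auto
  finally have "(norm (zh t - z (Suc t)))\<^sup>2 \<le> \<alpha>\<^sup>2 * K\<^sup>2 / \<mu>\<^sup>2 * (norm (zh t - z t))\<^sup>2"
    by (simp add: power_divide)
  hence "\<alpha> * ((g (md t) + W (zh t)) \<bullet> (zh t - w)) \<le> \<mu> / 2 *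
      ((norm (z t - w))\<^sup>2 - (norm (z (Suc t) - w))\<^sup>2
       - (1 - \<alpha>\<^sup>2 * K\<^sup>2 / \<mu>\<^sup>2) * (norm (zh t - z t))\<^sup>2)"
    unfolding eq using mu_pos by (intro mult_left_mono) (auto simp: algebra_simps)
  with * show ?thesis by linarith
qed

lemma lyapunov_Suc: "lyapunov (Suc t) \<le> (1 - \<alpha>) * lyapunov t"
proof -
  define p q r where "p = (norm (z t - w))\<^sup>2" and "q = (norm (zh t - z t))\<^sup>2"
    and "r = (norm (zh t - w))\<^sup>2"
  define c where "c = 1 - \<alpha>\<^sup>2 * K\<^sup>2 / \<mu>\<^sup>2"
  define gap where "gap = (g (md t) - g w) \<bullet> (zh t - w)"
  \<comment> \<open>The decrease is in terms of \<open>r\<close>, but contraction needs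
    \<open>p\<close>; the parallelogram law trades one for the other at the cost of
    \<open>q\<close>.\<close>
  have "p = (norm ((zh t - w) - (zh t - z t)))\<^sup>2"
    by (simp add: p_def)
  also have "\<dots> = 2 * r + 2 * q - (norm ((zh t - w) + (zh t - z t)))\<^sup>2"
    by (simp add: q_def r_def power2_norm_eq_inner algebra_simps inner_commute)
  finally have "p \<le> 2 * r + 2 * q"
    by simp
  hence young: "\<alpha> * \<mu> / 2 * p \<le> \<alpha> * \<mu> / 2 * (2 * r + 2 * q)"
    using alpha_props mu_pos by (intro mult_left_mono) auto
  \<comment> \<open>The quadratic equation for \<open>\<alpha>\<close> enters here: it makes the
    total coefficient of \<open>q\<close> zero.\<close>
  have "L * \<alpha>\<^sup>2 / 2 = \<mu> / 2 * (1 - \<alpha>\<^sup>2 * K\<^sup>2 / \<mu>\<^sup>2) - \<alpha> * \<mu>"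
  proof -
    have "\<alpha>\<^sup>2 * (L / \<mu>) = 1 - \<alpha>\<^sup>2 * K\<^sup>2 / \<mu>\<^sup>2 - 2 * \<alpha>"
      using alpha_props(3) by (simp add: algebra_simps)
    hence "\<mu> / 2 * (\<alpha>\<^sup>2 * (L / \<mu>)) = \<mu> / 2 * (1 - \<alpha>\<^sup>2 * K\<^sup>2 / \<mu>\<^sup>2 - 2 * \<alpha>)"
      by (rule arg_cong)
    moreover have "\<mu> / 2 * (\<alpha>\<^sup>2 * (L / \<mu>)) = L * \<alpha>\<^sup>2 / 2"
      using mu_pos by simp
    ultimately show ?thesis
      by (simp add: algebra_simps)
  qed
  hence cancel: "L * \<alpha>\<^sup>2 / 2 * q = \<mu> / 2 * (c * q) - \<alpha> * \<mu> * q"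
    by (simp only: c_def left_diff_distrib mult.assoc)
  show ?thesis
    using D_ag_Suc[of t] extragradient_step[of t] young cancel
    unfolding lyapunov_def p_def[symmetric] q_def[symmetric] r_def[symmetric] c_def[symmetric]
      gap_def[symmetric]
    by (simp add: algebra_simps diff_divide_distrib)
qed

text \<open>Iterate the contraction and use \<open>1 - \<alpha> \<le> exp (- \<alpha>)\<close>. The
  factor \<open>L / \<mu> + 1\<close> comes from bounding the initial divergence by smoothness, as
  \<open>ag 0 = z 0\<close>; the final divergence is nonnegative and is dropped.\<close>

theorem dist_bound:
  "(norm (z t - w))\<^sup>2 \<le> (norm (z 0 - w))\<^sup>2 * (L / \<mu> + 1) * exp (- (real t * \<alpha>))"
proof -
  have D_bounds: "0 \<le> D a" "D a \<le> L / 2 * (norm (a - w))\<^sup>2" for a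
    using convex smooth by (auto simp: D_def)
  have "lyapunov t \<le> (1 - \<alpha>) ^ t * lyapunov 0"
  proof (induction t)
    case (Suc t)
    have "lyapunov (Suc t) \<le> (1 - \<alpha>) * lyapunov t"
      by (rule lyapunov_Suc)
    also have "\<dots> \<le> (1 - \<alpha>) * ((1 - \<alpha>) ^ t * lyapunov 0)"
      using Suc alpha_props by (intro mult_left_mono) auto
    finally show ?case by (simp add: mult.assoc)
  qed simp
  also have "\<dots> \<le> exp (- \<alpha>) ^ t * lyapunov 0"
    using alpha_props exp_ge_add_one_self[of "- \<alpha>"] D_bounds mu_pos
    by (intro mult_right_mono power_mono) (auto simp: lyapunov_def)
  also have "\<dots> \<le> exp (- \<alpha>) ^ t * ((L + \<mu>) / 2 * (norm (z 0 - w))\<^sup>2)"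
    using D_bounds(2)[of "z 0"]
    by (intro mult_left_mono) (auto simp: lyapunov_def ag_0 add_divide_distrib algebra_simps)
  finally have "lyapunov t \<le> exp (- (real t * \<alpha>)) * ((L + \<mu>) / 2 * (norm (z 0 - w))\<^sup>2)"
    by (simp add: exp_of_nat_mult[symmetric])
  hence "\<mu> / 2 * (norm (z t - w))\<^sup>2 \<le> exp (- (real t * \<alpha>)) * ((L + \<mu>) / 2 * (norm (z 0 - w))\<^sup>2)"
    using D_bounds(1)[of "ag t"] by (simp add: lyapunov_def)
  also have "\<dots> = \<mu> / 2 * ((norm (z 0 - w))\<^sup>2 * (L / \<mu> + 1) * exp (- (real t * \<alpha>)))"
    using mu_pos by (simp add: field_simps)
  finally show ?thesis
    using mu_pos by (subst (asm) mult_le_cancel_left_pos) auto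
qed

end

section \<open>Reduction of AG-EG to the abstract scheme\<close>

theorem theorem5p2:
  fixes F :: "real^'n \<Rightarrow> real" and G :: "real^'m \<Rightarrow> real"
    and H :: "real^'n \<Rightarrow> real^'m \<Rightarrow> real"
    and B :: "real^'m^'n" and ux wx x0 :: "real^'n" and uy wy y0 :: "real^'m"
    and L_F \<mu>_F L_G \<mu>_G L_Str L_Bil \<mu>_star R \<alpha>_bar :: real
    and \<alpha> \<eta> :: "nat \<Rightarrow> real" and T :: nat
  assumes "CARD('m) \<le> CARD('n)"
    and "\<mu>_F > 0" and "\<mu>_G > 0"
    and "smooth_strongly_convex L_F \<mu>_F F"
    and "smooth_strongly_convex L_G \<mu>_G G"
    and "H = coupling B ux uy"
    and "saddle_point (\<lambda>x y. F x + H x y - G y) wx wy"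
    and "\<And>x y. saddle_point (\<lambda>x y. F x + H x y - G y) x y \<Longrightarrow> x = wx \<and> y = wy"
    and "L_Str = max L_F (\<mu>_F / \<mu>_G * L_G) - \<mu>_F"
    and "L_Bil = sqrt (lambda_max (transpose B ** B) * (\<mu>_F / \<mu>_G) + \<mu>_F\<^sup>2)"
    and "\<mu>_star = \<mu>_F"
    and "R = \<mu>_G / \<mu>_F"
    and "\<alpha>_bar = 1 / (1 + sqrt (1 + L_Str / \<mu>_star + L_Bil\<^sup>2 / \<mu>_star\<^sup>2))"
    and "\<And>t. \<alpha> t = \<alpha>_bar"
    and "\<And>t. \<eta> t = \<alpha>_bar / \<mu>_star"
    and "T \<ge> 1"
  shows "(norm (x_it (ag_eg F G H \<mu>_F \<mu>_G R \<alpha> \<eta> x0 y0 T) - wx))\<^sup>2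
           + R * (norm (y_it (ag_eg F G H \<mu>_F \<mu>_G R \<alpha> \<eta> x0 y0 T) - wy))\<^sup>2
       \<le> ((norm (x0 - wx))\<^sup>2 + R * (norm (y0 - wy))\<^sup>2) * (L_Str / \<mu>_star + 1)
           * exp (- real T / (1 + sqrt (1 + L_Str / \<mu>_star + L_Bil\<^sup>2 / \<mu>_star\<^sup>2)))"
proof -
  note mu = assms(2,3) and scF = assms(4) and scG = assms(5) and saddle = assms(7)
  \<comment> \<open>In the variable \<open>r *\<^sub>R y\<close> the weighted distance is Euclidean,
    both blocks have step size \<open>\<alpha>_bar / \<mu>_F\<close>, and both moduli become
    \<open>\<mu>_F\<close>.\<close>
  define r where "r = sqrt R"
  have r: "r > 0" "\<mu>_G = \<mu>_F * r\<^sup>2" "R = r\<^sup>2"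
    using mu assms(12) by (auto simp: r_def)
  define \<phi> :: "(real^'n) \<times> (real^'m) \<Rightarrow> real" where "\<phi> p =
    (F (fst p) - \<mu>_F / 2 * (norm (fst p))\<^sup>2)
    + (G (snd p /\<^sub>R r) - \<mu>_G / 2 * (norm (snd p /\<^sub>R r))\<^sup>2)" for p
  define g :: "(real^'n) \<times> (real^'m) \<Rightarrow> (real^'n) \<times> (real^'m)" where "g p =
    (gradient F (fst p) - \<mu>_F *\<^sub>R fst p,
     (gradient G (snd p /\<^sub>R r) - \<mu>_G *\<^sub>R (snd p /\<^sub>R r)) /\<^sub>R r)" for p
  define W :: "(real^'n) \<times> (real^'m) \<Rightarrow> (real^'n) \<times> (real^'m)" where "W p =
    (B *v (snd p /\<^sub>R r) - ux + \<mu>_F *\<^sub>R fst p,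
     - ((transpose B *v fst p + uy) /\<^sub>R r) + \<mu>_F *\<^sub>R snd p)" for p
  define s where "s t = ag_eg F G H \<mu>_F \<mu>_G R \<alpha> \<eta> x0 y0 t" for t
  define z where "z t = (x_it (s t), r *\<^sub>R y_it (s t))" for t
  define ag where "ag t = (x_ag (s t), r *\<^sub>R y_ag (s t))" for t
  define md where "md t = (x_md (s t), r *\<^sub>R y_md (s t))" for t
  define zh where "zh t = z t - (\<alpha>_bar / \<mu>_F) *\<^sub>R (g (md t) + W (z t))" for t
  define w where "w = (wx, r *\<^sub>R wy)"

  have bregman: "\<phi> a - \<phi> b - g b \<bullet> (a - b) =
      ((F (fst a) - \<mu>_F / 2 * (norm (fst a))\<^sup>2) - (F (fst b) - \<mu>_F / 2 * (norm (fst b))\<^sup>2)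
        - (gradient F (fst b) - \<mu>_F *\<^sub>R fst b) \<bullet> (fst a - fst b))
      + ((G (snd a /\<^sub>R r) - \<mu>_G / 2 * (norm (snd a /\<^sub>R r))\<^sup>2)
        - (G (snd b /\<^sub>R r) - \<mu>_G / 2 * (norm (snd b /\<^sub>R r))\<^sup>2)
        - (gradient G (snd b /\<^sub>R r) - \<mu>_G *\<^sub>R (snd b /\<^sub>R r)) \<bullet> (snd a /\<^sub>R r - snd b /\<^sub>R r))" for a b
    unfolding \<phi>_def g_def
    by (simp add: inner_prod_def scaleR_right_diff_distrib[symmetric])
  have W_diff: "W a - W b =
      (B *v ((snd a - snd b) /\<^sub>R r) + \<mu>_F *\<^sub>R (fst a - fst b),
       - ((transpose B *v (fst a - fst b)) /\<^sub>R r) + \<mu>_F *\<^sub>R (snd a - snd b))" for a b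
    unfolding W_def
    by (simp add: matrix_vector_mult_diff_distrib algebra_simps)
  have skew: "d \<bullet> (B *v (e /\<^sub>R r)) = ((transpose B *v d) /\<^sub>R r) \<bullet> e" for d e
    by (simp add: matrix_vector_mult_scaleR dot_lmul_matrix transpose_matrix_vector)
  let ?\<Lambda> = "lambda_max (transpose B ** B)"
  have K2: "L_Bil\<^sup>2 = ?\<Lambda> / r\<^sup>2 + \<mu>_F\<^sup>2"
    using r mu lambda_max_gram(2)[of B] by (simp add: assms(10) real_sqrt_pow2)

  interpret accelerated_extragradient \<phi> g W w L_Str L_Bil \<mu>_F \<alpha>_bar z zh ag md
  proof
    show "0 < \<mu>_F" by fact
    show "0 \<le> L_Str"
      using smooth_strongly_convex_le[OF scF] by (simp add: assms(9))
    show "\<alpha>_bar = 1 / (1 + sqrt (1 + L_Str / \<mu>_F + L_Bil\<^sup>2 / \<mu>_F\<^sup>2))"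
      by (simp add: assms(11,13))
  next
    fix a b
    show "0 \<le> \<phi> a - \<phi> b - g b \<bullet> (a - b)"
      unfolding bregman
      by (intro add_nonneg_nonneg smooth_strongly_convex_shift(1)[OF scF]
          smooth_strongly_convex_shift(1)[OF scG])
    have "\<phi> a - \<phi> b - g b \<bullet> (a - b) \<le> (L_F - \<mu>_F) / 2 * (norm (fst a - fst b))\<^sup>2
        + (L_G - \<mu>_G) / 2 * (norm (snd a /\<^sub>R r - snd b /\<^sub>R r))\<^sup>2"
      unfolding bregman
      by (intro add_mono smooth_strongly_convex_shift(2)[OF scF]
          smooth_strongly_convex_shift(2)[OF scG])
    also have "snd a /\<^sub>R r - snd b /\<^sub>R r = (snd a - snd b) /\<^sub>R r"
      by (simp add: scaleR_right_diff_distrib)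
    \<comment> \<open>Rescaling divides \<open>L_G - \<mu>_G\<close> by
      \<open>r\<^sup>2 = \<mu>_G / \<mu>_F\<close>; this explains the second entry of the maximum in
      \<open>L_Str\<close>.\<close>
    also have "(L_G - \<mu>_G) / 2 * (norm ((snd a - snd b) /\<^sub>R r))\<^sup>2
        = (\<mu>_F / \<mu>_G * L_G - \<mu>_F) / 2 * (norm (snd a - snd b))\<^sup>2"
      using r(1) mu(1) by (simp add: r(2) power_mult_distrib power_divide divide_simps)
    also have "(L_F - \<mu>_F) / 2 * (norm (fst a - fst b))\<^sup>2
          + (\<mu>_F / \<mu>_G * L_G - \<mu>_F) / 2 * (norm (snd a - snd b))\<^sup>2
        \<le> L_Str / 2 * (norm (fst a - fst b))\<^sup>2 + L_Str / 2 * (norm (snd a - snd b))\<^sup>2"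
      unfolding assms(9) by (intro add_mono mult_right_mono divide_right_mono diff_right_mono) auto
    also have "\<dots> = L_Str / 2 * (norm (a - b))\<^sup>2"
      by (simp add: power2_norm_eq_inner[of "a - b"] inner_prod_def power2_norm_eq_inner[symmetric]
          algebra_simps)
    finally show "\<phi> a - \<phi> b - g b \<bullet> (a - b) \<le> L_Str / 2 * (norm (a - b))\<^sup>2" .
    define d e where "d = fst a - fst b" and "e = snd a - snd b"
    have ab: "a - b = (d, e)"
      by (simp add: d_def e_def prod_eq_iff)
    have norm_ab: "(norm (a - b))\<^sup>2 = (norm d)\<^sup>2 + (norm e)\<^sup>2"
      unfolding ab by (simp add: power2_norm_eq_inner inner_prod_def)
    \<comment> \<open>These are the coupling parts of \<open>W a - W b\<close>. By
      \<open>d \<bullet> p = q \<bullet> e\<close> they contribute nothing to the monotonicity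
      product, and their cross terms with the identity part cancel in the norm.\<close>
    define p q where "p = B *v (e /\<^sub>R r)" and "q = (transpose B *v d) /\<^sub>R r"
    have Wd: "W a - W b = (p + \<mu>_F *\<^sub>R d, - q + \<mu>_F *\<^sub>R e)"
      unfolding W_diff by (simp add: d_def e_def p_def q_def)
    have pq: "d \<bullet> p = q \<bullet> e"
      unfolding p_def q_def by (rule skew)
    show "\<mu>_F * (norm (a - b))\<^sup>2 \<le> (W a - W b) \<bullet> (a - b)"
      unfolding norm_ab unfolding Wd ab using pq
      by (simp add: inner_prod_def inner_commute power2_norm_eq_inner algebra_simps)
    have "(norm (W a - W b))\<^sup>2 = (norm p)\<^sup>2 + (norm q)\<^sup>2 + \<mu>_F\<^sup>2 * (norm (a - b))\<^sup>2"
      unfolding norm_ab unfolding Wd using pq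
      by (simp add: inner_prod_def inner_commute power2_norm_eq_inner power2_eq_square[of \<mu>_F]
          algebra_simps)
    also have "(norm p)\<^sup>2 \<le> ?\<Lambda> / r\<^sup>2 * (norm e)\<^sup>2"
      using lambda_max_gram(1)[of B "e /\<^sub>R r"] r(1)
      by (simp add: p_def power_mult_distrib power_divide divide_simps)
    also have "(norm q)\<^sup>2 \<le> ?\<Lambda> / r\<^sup>2 * (norm d)\<^sup>2"
      using lambda_max_gram_transpose[of B d] r(1)
      by (simp add: q_def power_mult_distrib power_divide divide_simps)
    finally show "(norm (W a - W b))\<^sup>2 \<le> L_Bil\<^sup>2 * (norm (a - b))\<^sup>2"
      by (simp add: K2 norm_ab algebra_simps)
  next
    have "gradient F wx + (B *v wy - ux) = 0"
    proof (rule smooth_minimizer_stationary[OF scF])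
      fix x
      have "F wx + H wx wy - G wy \<le> F x + H x wy - G wy"
        using saddle unfolding saddle_point_def by blast
      thus "F wx + (B *v wy - ux) \<bullet> wx \<le> F x + (B *v wy - ux) \<bullet> x"
        by (simp add: assms(6) coupling_def inner_commute algebra_simps)
    qed
    moreover have "gradient G wy + - (transpose B *v wx + uy) = 0"
    proof (rule smooth_minimizer_stationary[OF scG])
      fix y
      have "F wx + H wx y - G y \<le> F wx + H wx wy - G wy"
        using saddle unfolding saddle_point_def by blast
      thus "G wy + - (transpose B *v wx + uy) \<bullet> wy \<le> G y + - (transpose B *v wx + uy) \<bullet> y"
        by (simp add: assms(6) coupling_def algebra_simps transpose_matrix_vector dot_lmul_matrix)
    qed
    ultimately have "gradient F wx = ux - B *v wy" "gradient G wy = transpose B *v wx + uy"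
      by (simp_all add: algebra_simps)
    thus "g w + W w = 0"
      using r(1) by (simp add: g_def W_def w_def r(2) zero_prod_def power2_eq_square algebra_simps)
  next
    show "ag 0 = z 0"
      by (simp add: ag_def z_def s_def)
  next
    fix t
    show "md t = (1 - \<alpha>_bar) *\<^sub>R ag t + \<alpha>_bar *\<^sub>R z t"
    proof (cases t)
      \<comment> \<open>The initial \<open>md\<close> is set directly and not by averaging, but all
        initial points coincide.\<close>
      case 0
      thus ?thesis
        by (simp add: md_def ag_def z_def s_def algebra_simps)
    next
      case (Suc k)
      have "x_md (s t) = (1 - \<alpha>_bar) *\<^sub>R x_ag (s t) + \<alpha>_bar *\<^sub>R x_it (s t)"
        "y_md (s t) = (1 - \<alpha>_bar) *\<^sub>R y_ag (s t) + \<alpha>_bar *\<^sub>R y_it (s t)"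
        by (simp_all add: Suc s_def ag_eg_step_def Let_def assms(14))
      thus ?thesis
        by (simp add: md_def ag_def z_def scaleR_right_distrib mult.commute)
    qed
    show "zh t = z t - (\<alpha>_bar / \<mu>_F) *\<^sub>R (g (md t) + W (z t))"
      by (rule zh_def)
    \<comment> \<open>The state does not store the half-step iterates; \<open>xh\<close> and
      \<open>yh\<close> restate them so that \<open>zh_eq\<close> can match them with
      \<open>zh t\<close>.\<close>
    define xh where "xh = x_it (s t) - (\<alpha>_bar / \<mu>_F) *\<^sub>R (gradient F (x_md (s t))
      + (B *v y_it (s t) - ux) - \<mu>_F *\<^sub>R (x_md (s t) - x_it (s t)))"
    define yh where "yh = y_it (s t) - (\<alpha>_bar / \<mu>_F / R) *\<^sub>R (- (transpose B *v x_it (s t) + uy)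
      + gradient G (y_md (s t)) - \<mu>_G *\<^sub>R (y_md (s t) - y_it (s t)))"
    have s_Suc: "s (Suc t) = ag_eg_step F G H \<mu>_F \<mu>_G R \<alpha> \<eta> (Suc t) (s t)"
      by (simp add: s_def)
    note step = s_Suc ag_eg_step_def Let_def assms(6,11,14,15) gradient_coupling
      xh_def yh_def
    have scale: "r *\<^sub>R ((c / R) *\<^sub>R v) = c *\<^sub>R (v /\<^sub>R r)" for c and v :: "real^'m"
      using r(1) by (simp add: r(3) power2_eq_square divide_inverse)
    \<comment> \<open>Since \<open>\<mu>_G / r = \<mu>_F * r\<close>, the correction splits: its
      \<open>md\<close> part joins \<open>g\<close>, its iterate part becomes the identity part of
      \<open>W\<close>.\<close>
    have pull: "(- a + b - \<mu>_G *\<^sub>R (c - d)) /\<^sub>R r =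
        (b - \<mu>_G *\<^sub>R c) /\<^sub>R r + (- (a /\<^sub>R r) + \<mu>_F *\<^sub>R (r *\<^sub>R d))" for a b c d :: "real^'m"
      using r(1) by (simp add: r(2) power2_eq_square algebra_simps)
    have zh_eq: "zh t = (xh, r *\<^sub>R yh)"
      unfolding zh_def xh_def yh_def scaleR_right_diff_distrib[of r] scale pull
      using r(1) by (simp add: z_def g_def W_def md_def) (simp add: algebra_simps)
    show "ag (Suc t) = (1 - \<alpha>_bar) *\<^sub>R ag t + \<alpha>_bar *\<^sub>R zh t"
    proof -
      have "x_ag (s (Suc t)) = (1 - \<alpha>_bar) *\<^sub>R x_ag (s t) + \<alpha>_bar *\<^sub>R xh"
        "y_ag (s (Suc t)) = (1 - \<alpha>_bar) *\<^sub>R y_ag (s t) + \<alpha>_bar *\<^sub>R yh"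
        by (simp_all add: step)
      thus ?thesis
        unfolding zh_eq by (simp add: ag_def scaleR_right_distrib mult.commute)
    qed
    have "x_it (s (Suc t)) = x_it (s t) - (\<alpha>_bar / \<mu>_F) *\<^sub>R (gradient F (x_md (s t))
        + (B *v yh - ux) - \<mu>_F *\<^sub>R (x_md (s t) - xh))"
      and y: "y_it (s (Suc t)) = y_it (s t) - (\<alpha>_bar / \<mu>_F / R) *\<^sub>R (- (transpose B *v xh + uy)
        + gradient G (y_md (s t)) - \<mu>_G *\<^sub>R (y_md (s t) - yh))"
      by (simp_all add: step)
    moreover have "r *\<^sub>R y_it (s (Suc t)) = r *\<^sub>R y_it (s t)
        - (\<alpha>_bar / \<mu>_F) *\<^sub>R ((gradient G (y_md (s t)) - \<mu>_G *\<^sub>R y_md (s t)) /\<^sub>R r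
            + (- ((transpose B *v xh + uy) /\<^sub>R r) + \<mu>_F *\<^sub>R (r *\<^sub>R yh)))"
      unfolding y scaleR_right_diff_distrib[of r] scale pull ..
    ultimately show "z (Suc t) = z t - (\<alpha>_bar / \<mu>_F) *\<^sub>R (g (md t) + W (zh t))"
      using r(1) unfolding zh_eq by (simp add: z_def g_def W_def md_def) (simp add: algebra_simps)
  qed

  have norm_z: "(norm (z t - w))\<^sup>2 = (norm (x_it (s t) - wx))\<^sup>2 + R * (norm (y_it (s t) - wy))\<^sup>2" for t
    using r(1) unfolding z_def w_def
    by (simp add: power2_norm_eq_inner inner_prod_def r(3) power2_eq_square[of r]
        scaleR_right_diff_distrib[symmetric])
  have init: "x_it (s 0) = x0" "y_it (s 0) = y0"
    by (simp_all add: s_def)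
  show ?thesis
    using dist_bound[of T] unfolding norm_z init by (simp add: s_def assms(11,13))
qed

end
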